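(* Let $n\ge 1$ be an integer and let $\delta\in(0,n]$. Then there exists a subset $E\subset\mathbb R^n$ such that $$\dim_{\mathcal H}(E)=\delta\quad\text{and}\quad \mathcal H^\delta(E)=0.$$
   Context: For $s\ge 0$, $\epsilon\in(0,\infty]$ and $E\subset\mathbb R^n$, set $$\mathcal H_\epsilon^s(E):=\inf\Big\{\sum_i[l(Q_i)]^s:\ E\subset\bigcup_iQ_i,\ l(Q_i)<\epsilon\Big\},$$ where the infimum is taken over all finite or countable coverings $\{Q_i\}_i$ of $E$ by cubes of $\mathbb R^n$, and $l(Q)$ denotes the edge length of the cube $Q$. The $s$-dimensional Hausdorff measure of $E$ is $\mathcal H^s(E):=\lim_{\epsilon\to0^+}\mathcal H^s_\epsilon(E)=\sup_{\epsilon>0}\mathcal H^s_\epsilon(E)$. The Hausdorff dimension of a nonempty set $E\subset\mathbb R^n$ is $\dim_{\mathcal H}(E):=\inf\{s\ge0:\ \mathcal H^s(E)=0\}$, and the Hausdorff dimension of the empty set is $0$. *)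

theory Defs
  imports "HOL-Analysis.Analysis"
begin

text \<open>
  Cubes are closed, have their edges parallel to the coordinate axes and have positive edge
  length \<open>l\<close> (in particular \<open>l powr 0 = 1\<close>, so the case \<open>s = 0\<close> below counts cubes).
\<close>

definition cube :: "real ^ 'n \<Rightarrow> real \<Rightarrow> (real ^ 'n) set" where
  "cube a l = cbox a (\<chi> i. a $ i + l)"

text \<open>
  A finite or countable covering is a family indexed by a set \<open>I\<close> of natural numbers, whose
  \<open>i\<close>-th member is the cube with lower corner \<open>a i\<close> and edge length \<open>l i\<close>.
\<close>

definition cube_coverings ::
  "ennreal \<Rightarrow> (real ^ 'n) set \<Rightarrow> (nat set \<times> (nat \<Rightarrow> real ^ 'n) \<times> (nat \<Rightarrow> real)) set" where
  "cube_coverings \<epsilon> E =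
     {(I, a, l). (\<forall>i\<in>I. 0 < l i \<and> ennreal (l i) < \<epsilon>) \<and> E \<subseteq> (\<Union>i\<in>I. cube (a i) (l i))}"

definition hausdorff_premeasure :: "real \<Rightarrow> ennreal \<Rightarrow> (real ^ 'n) set \<Rightarrow> ennreal" where
  "hausdorff_premeasure s \<epsilon> E =
     (INF (I, a, l) \<in> cube_coverings \<epsilon> E. \<Sum>\<^sub>\<infinity>i\<in>I. ennreal (l i powr s))"

definition hausdorff_measure :: "real \<Rightarrow> (real ^ 'n) set \<Rightarrow> ennreal" where
  "hausdorff_measure s E = (SUP \<epsilon>\<in>{0<..}. hausdorff_premeasure s \<epsilon> E)"

text \<open>
  The dimension is taken in \<^typ>\<open>ennreal\<close>, so that an infimum over an empty set of exponents
  would be infinite rather than an unspecified real number.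
\<close>

definition hausdorff_dim :: "(real ^ 'n) set \<Rightarrow> ennreal" where
  "hausdorff_dim E =
     (if E = {} then 0 else (INF s\<in>{s. 0 \<le> s \<and> hausdorff_measure s E = 0}. ennreal s))"

lemma hausdorff_premeasure_antimono:
  assumes "\<epsilon> \<le> \<epsilon>'"
  shows "hausdorff_premeasure s \<epsilon>' E \<le> hausdorff_premeasure s \<epsilon> E"
  unfolding hausdorff_premeasure_def
  by (rule INF_superset_mono) (use assms in \<open>auto simp: cube_coverings_def\<close>)

lemma hausdorff_premeasure_tendsto:
  "((\<lambda>\<epsilon>. hausdorff_premeasure s \<epsilon> E) \<longlongrightarrow> hausdorff_measure s E) (at_right 0)"
proof (rule order_tendstoI)
  fix c assume "c < hausdorff_measure s E"
  then obtain \<epsilon>0 where e: "0 < \<epsilon>0" "c < hausdorff_premeasure s \<epsilon>0 E"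
    by (auto simp: hausdorff_measure_def less_SUP_iff)
  have "c < hausdorff_premeasure s \<epsilon> E" if "\<epsilon> < \<epsilon>0" for \<epsilon>
    using less_le_trans[OF e(2) hausdorff_premeasure_antimono] that by (simp add: less_imp_le)
  then show "\<forall>\<^sub>F \<epsilon> in at_right 0. c < hausdorff_premeasure s \<epsilon> E"
    using e(1) unfolding eventually_at_right[OF e(1)] by blast
next
  fix c assume c: "hausdorff_measure s E < c"
  have "hausdorff_premeasure s \<epsilon> E < c" if "0 < \<epsilon>" for \<epsilon>
  proof -
    have "hausdorff_premeasure s \<epsilon> E \<le> hausdorff_measure s E"
      unfolding hausdorff_measure_def by (rule SUP_upper) (use that in simp)
    then show ?thesis
      using c by (rule le_less_trans)
  qed
  then show "\<forall>\<^sub>F \<epsilon> in at_right 0. hausdorff_premeasure s \<epsilon> E < c"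
    unfolding eventually_at_right[OF zero_less_one] by (blast intro: zero_less_one)
qed

end

theory Submission
  imports Defs "HOL-Real_Asymp.Real_Asymp"
begin

text \<open>
  Let \<open>C\<close> be the set of all sums \<open>\<Sum>i. b i * r i\<close> with binary digits \<open>b i\<close>, where \<open>r\<close> at least halves
  at every step. The first \<open>m\<close> digits split \<open>C ^ n\<close> into \<open>2 ^ (n * m)\<close> pieces lying in cubes of edge
  \<open>2 * r m\<close>. With \<open>r m = 2 powr (- n * m / \<delta>) / (m + 1)\<close> the critical sums
  \<open>2 ^ (n * m) * (2 * r m) powr \<delta>\<close> tend to \<open>0\<close>, and the factor \<open>1 / (m + 1)\<close> is too mild to matter
  for exponents below \<open>\<delta>\<close>. For these, reading the digits as those of a number \<open>u\<close> in \<open>[0, 1)\<close>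
  parametrises \<open>C\<close>; two parameters whose images differ by at most \<open>2 * r m\<close> differ by at most
  \<open>3 / 2 ^ m\<close>, so a cheap covering of \<open>C ^ n\<close> by cubes would pull back to a covering of the unit cube
  of too small Lebesgue measure.
\<close>

section \<open>Binary digits, volumes of cubes, and bounds for coverings\<close>

text \<open>For \<open>u\<close> in [0, 1) this is the digit of weight \<open>1 / 2 ^ Suc i\<close>.
  Writing it with floors makes the recursion between consecutive levels of
  \<open>\<lfloor>2 ^ m * u\<rfloor>\<close> linear.\<close>

definition binary_digit :: "nat \<Rightarrow> real \<Rightarrow> real" where
  "binary_digit i u = real_of_int (\<lfloor>2 ^ Suc i * u\<rfloor> - 2 * \<lfloor>2 ^ i * u\<rfloor>)"

lemma binary_digit_cases: "binary_digit i u = 0 \<or> binary_digit i u = 1"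
proof -
  have "\<lfloor>2 ^ Suc i * u\<rfloor> - 2 * \<lfloor>2 ^ i * u\<rfloor> \<in> {0, 1}"
    by (simp add: mult.assoc) linarith
  then show ?thesis
    by (auto simp: binary_digit_def)
qed

lemma binary_digit_bounds: "0 \<le> binary_digit i u" "binary_digit i u \<le> 1"
  using binary_digit_cases[of i u] by auto

lemma card_vec_le:
  assumes "finite V"
  shows "finite {x :: 'a ^ 'n::finite. \<forall>j. x $ j \<in> V}"
    and "card {x :: 'a ^ 'n::finite. \<forall>j. x $ j \<in> V} \<le> card V ^ CARD('n)"
proof -
  let ?F = "UNIV \<rightarrow>\<^sub>E V :: ('n \<Rightarrow> 'a) set"
  have sub: "{x :: 'a ^ 'n. \<forall>j. x $ j \<in> V} \<subseteq> (\<lambda>f. \<chi> j. f j) ` ?F"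
  proof
    fix x :: "'a ^ 'n" assume "x \<in> {x. \<forall>j. x $ j \<in> V}"
    then have "x = (\<chi> j. (($) x) j)" "(($) x) \<in> ?F"
      by auto
    then show "x \<in> (\<lambda>f. \<chi> j. f j) ` ?F"
      by blast
  qed
  have fin: "finite ?F"
    using assms by (intro finite_PiE) auto
  then show "finite {x :: 'a ^ 'n. \<forall>j. x $ j \<in> V}"
    using sub by (rule finite_surj)
  have "card {x :: 'a ^ 'n. \<forall>j. x $ j \<in> V} \<le> card ?F"
    using fin sub by (rule surj_card_le)
  also have "\<dots> = card V ^ CARD('n)"
    by (simp add: card_PiE)
  finally show "card {x :: 'a ^ 'n. \<forall>j. x $ j \<in> V} \<le> card V ^ CARD('n)" .
qed

lemma emeasure_lborel_cube:
  assumes "0 \<le> l"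
  shows "emeasure lborel (cube (a :: real ^ 'n) l) = ennreal (l ^ CARD('n))"
proof -
  have "cbox a (\<chi> i. a $ i + l) = cbox a (a + (\<chi> i. l))"
    by (rule arg_cong[where f = "cbox a"]) (simp add: vec_eq_iff)
  then show ?thesis
    using assms
    by (simp add: cube_def emeasure_lborel_cbox_eq Basis_vec_def inner_axis axis_eq_axis
        prod.UNION_disjoint)
qed

lemma hausdorff_measure_eq_0I:
  assumes "\<And>\<epsilon>. 0 < \<epsilon> \<Longrightarrow> hausdorff_premeasure s \<epsilon> E = 0"
  shows "hausdorff_measure s E = 0"
proof -
  have "hausdorff_measure s E \<le> 0"
    unfolding hausdorff_measure_def using assms by (intro SUP_least) auto
  then show ?thesis
    by simp
qed

lemma hausdorff_premeasure_le_finite: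
  fixes S :: "(real ^ 'n) set"
  assumes S: "finite S" and l: "0 < l" "ennreal l < \<epsilon>" and E: "E \<subseteq> (\<Union>a\<in>S. cube a l)"
  shows "hausdorff_premeasure s \<epsilon> E \<le> ennreal (real (card S) * l powr s)"
proof -
  \<comment> \<open>Coverings are indexed by naturals, so the corners in \<open>S\<close> are
    enumerated.\<close>
  obtain f where f: "bij_betw f {0..<card S} S"
    using ex_bij_betw_nat_finite[OF S] by blast
  have "(\<Union>i\<in>{0..<card S}. cube (f i) l) = (\<Union>a\<in>f ` {0..<card S}. cube a l)"
    by (simp only: image_image)
  also have "f ` {0..<card S} = S"
    using f by (rule bij_betw_imp_surj_on)
  finally have "({0..<card S}, f, \<lambda>_. l) \<in> cube_coverings \<epsilon> E"
    using l E by (simp add: cube_coverings_def)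
  then have "hausdorff_premeasure s \<epsilon> E \<le> (\<Sum>\<^sub>\<infinity>i\<in>{0..<card S}. ennreal (l powr s))"
    unfolding hausdorff_premeasure_def by (rule INF_lower2) (simp only: prod.case order_refl)
  also have "\<dots> = ennreal (real (card S) * l powr s)"
    by (simp add: ennreal_of_nat_eq_real_of_nat flip: ennreal_mult)
  finally show ?thesis .
qed

text \<open>Links countable subadditivity, which yields a series over all naturals, with the cost of
  a covering, a sum over its index set.\<close>

lemma suminf_le_infsum_ennreal:
  fixes f g :: "nat \<Rightarrow> ennreal"
  assumes "\<And>i. i \<in> I \<Longrightarrow> f i \<le> g i" "\<And>i. i \<notin> I \<Longrightarrow> f i = 0"
  shows "(\<Sum>i. f i) \<le> (\<Sum>\<^sub>\<infinity>i\<in>I. g i)"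
proof (rule suminf_le_const)
  fix n
  have "sum f {..<n} = sum f ({..<n} \<inter> I)"
    using assms by (intro sum.mono_neutral_right) auto
  also have "\<dots> \<le> sum g ({..<n} \<inter> I)"
    using assms by (intro sum_mono) auto
  also have "\<dots> = (\<Sum>\<^sub>\<infinity>i\<in>{..<n} \<inter> I. g i)"
    by simp
  also have "\<dots> \<le> (\<Sum>\<^sub>\<infinity>i\<in>I. g i)"
    by (intro infsum_mono_neutral nonneg_summable_on_complete) auto
  finally show "sum f {..<n} \<le> (\<Sum>\<^sub>\<infinity>i\<in>I. g i)" .
qed auto

section \<open>Digit sums with weights that at least halve\<close>

locale halving_sequence =
  fixes r :: "nat \<Rightarrow> real"
  assumes r_pos: "0 < r m"
    and r_Suc: "2 * r (Suc m) \<le> r m"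
begin

definition partial :: "nat \<Rightarrow> real \<Rightarrow> real" where
  "partial m u = (\<Sum>i<m. r i * binary_digit i u)"

definition cantor_map :: "real \<Rightarrow> real" where
  "cantor_map u = (\<Sum>i. r i * binary_digit i u)"

text \<open>The n-fold product of the image of [0, 1). Only expansions of numbers in [0, 1) occur,
  hence no digit sequence that is eventually 1.\<close>

definition cantor_dust :: "(real ^ 'n) set" where
  "cantor_dust = {x. \<forall>j. x $ j \<in> cantor_map ` {0..<1}}"

lemma r_le: "r m \<le> r 0 / 2 ^ m"
proof (induction m)
  case (Suc m)
  have "r (Suc m) \<le> r m / 2"
    using r_Suc[of m] by simp
  also have "\<dots> \<le> r 0 / 2 ^ m / 2"
    using Suc by (rule divide_right_mono) simp
  finally show ?case
    by (simp add: mult.commute)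
qed simp

lemma r_tendsto_0: "r \<longlonglongrightarrow> 0"
proof (rule tendsto_sandwich[of "\<lambda>_. 0" r _ "\<lambda>m. r 0 / 2 ^ m"])
  show "(\<lambda>m. r 0 / 2 ^ m) \<longlonglongrightarrow> 0"
    by real_asymp
qed (use r_pos r_le in \<open>auto intro!: always_eventually less_imp_le\<close>)

lemma term_bounds: "0 \<le> r i * binary_digit i u" "r i * binary_digit i u \<le> r i"
  using r_pos[of i] binary_digit_bounds[of i u] by (auto simp: mult_le_cancel_left1)

text \<open>The subtracted term closes the induction: one more digit adds at most
  \<open>r (m + k)\<close>, and \<open>2 * r (m + k)\<close> exceeds
  \<open>2 * r (Suc (m + k))\<close> by at least that much.\<close>

lemma partial_add_le: "partial (m + k) u \<le> partial m u + 2 * r m - 2 * r (m + k)"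
proof (induction k)
  case (Suc k)
  then show ?case
    using r_Suc[of "m + k"] term_bounds(2)[of "m + k" u] by (simp add: partial_def)
qed simp

lemma summable_terms: "summable (\<lambda>i. r i * binary_digit i u)"
proof (rule summable_comparison_test')
  show "summable (\<lambda>i. r 0 * (1 / 2) ^ i)"
    by (intro summable_mult summable_geometric) simp
  show "norm (r i * binary_digit i u) \<le> r 0 * (1 / 2) ^ i" if "i \<ge> 0" for i
    using term_bounds[of i u] r_le[of i] by (simp add: power_divide)
qed

lemma partial_le_cantor_map: "partial m u \<le> cantor_map u"
  unfolding partial_def cantor_map_def
  by (rule sum_le_suminf[OF summable_terms]) (use term_bounds in auto)

lemma cantor_map_le_partial: "cantor_map u \<le> partial m u + 2 * r m"
proof -
  have "(\<lambda>k. partial k u) \<longlonglongrightarrow> cantor_map u"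
    unfolding partial_def cantor_map_def by (rule summable_LIMSEQ[OF summable_terms])
  then have "(\<lambda>k. partial (k + m) u) \<longlonglongrightarrow> cantor_map u"
    by (rule LIMSEQ_ignore_initial_segment)
  then show ?thesis
  proof (rule LIMSEQ_le_const2)
    show "\<exists>N. \<forall>k\<ge>N. partial (k + m) u \<le> partial m u + 2 * r m"
    proof (intro exI allI impI)
      fix k
      show "partial (k + m) u \<le> partial m u + 2 * r m"
        using partial_add_le[of m k u] r_pos[of "m + k"] by (simp add: add.commute)
    qed
  qed
qed

text \<open>
  Comparing \<open>m\<close>-digit truncations on both sides makes the estimate pass from \<open>m\<close> to \<open>m + 1\<close> by
  \<open>2 * r (m + 1) \<le> r m\<close> alone, with no case distinction on the first differing digit.
\<close>
lemma partial_diff_ge: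
  assumes "0 \<le> u" "u \<le> v" "v < 1"
  shows "2 * r m * real_of_int (\<lfloor>2 ^ m * v\<rfloor> - \<lfloor>2 ^ m * u\<rfloor>) \<le> partial m v - partial m u"
proof (induction m)
  case 0
  have "\<lfloor>u\<rfloor> = 0" "\<lfloor>v\<rfloor> = 0"
    using assms by (auto intro: floor_unique)
  then show ?case
    by (simp add: partial_def)
next
  case (Suc m)
  define d where "d k = real_of_int (\<lfloor>2 ^ k * v\<rfloor> - \<lfloor>2 ^ k * u\<rfloor>)" for k
  have "0 \<le> d (Suc m)"
    unfolding d_def using assms by (simp add: floor_mono)
  then have "2 * r (Suc m) * d (Suc m) \<le> r m * d (Suc m)"
    using r_Suc by (rule mult_right_mono[rotated])
  \<comment> \<open>\<open>d (Suc m) - 2 * d m\<close> is the difference of the \<open>m\<close>-th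
    digits of \<open>v\<close> and \<open>u\<close>, so the last summand is the increment of the
    partial sums.\<close>
  also have "\<dots> = 2 * r m * d m + r m * (d (Suc m) - 2 * d m)"
    by (simp add: algebra_simps)
  also have "\<dots> \<le> partial m v - partial m u + r m * (d (Suc m) - 2 * d m)"
    using Suc by (simp add: d_def)
  also have "\<dots> = partial (Suc m) v - partial (Suc m) u"
    by (simp add: partial_def binary_digit_def d_def algebra_simps)
  finally show ?case
    by (simp add: d_def)
qed

text \<open>Truncating after \<open>m\<close> digits lowers a value by at most
  \<open>2 * r m\<close>, so the truncations differ by at most \<open>4 * r m\<close>. By
  \<open>partial_diff_ge\<close> the floors at level \<open>m\<close> differ by at most 2, hence the
  numbers \<open>2 ^ m * u\<close> and \<open>2 ^ m * v\<close> by at most 3.\<close>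

lemma cantor_map_expanding:
  assumes "0 \<le> u" "u \<le> v" "v < 1" "cantor_map v - cantor_map u \<le> 2 * r m"
  shows "v - u \<le> 3 / 2 ^ m"
proof -
  let ?d = "\<lfloor>2 ^ m * v\<rfloor> - \<lfloor>2 ^ m * u\<rfloor>"
  have "2 * r m * real_of_int ?d \<le> partial m v - partial m u"
    using assms by (intro partial_diff_ge)
  also have "\<dots> \<le> 2 * r m * 2"
    using assms(4) partial_le_cantor_map[of m v] cantor_map_le_partial[of u m] by linarith
  finally have "real_of_int ?d \<le> 2"
    using r_pos[of m] by simp
  then have "2 ^ m * v - 2 ^ m * u \<le> 3"
    by linarith
  then show ?thesis
    by (simp add: field_simps)
qed

text \<open>A new digit 0 or 1 either keeps a truncated sum or shifts it by \<open>r m\<close>, so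
  the set at most doubles.\<close>

lemma card_partial: "finite (range (partial m)) \<and> card (range (partial m)) \<le> 2 ^ m"
proof (induction m)
  case 0
  have "range (partial 0) = {0}"
    by (auto simp: partial_def)
  then show ?case
    by simp
next
  case (Suc m)
  let ?V = "range (partial m)"
  have sub: "range (partial (Suc m)) \<subseteq> ?V \<union> (+) (r m) ` ?V"
  proof
    fix x assume "x \<in> range (partial (Suc m))"
    then obtain u where "x = partial m u + r m * binary_digit m u"
      by (auto simp: partial_def)
    then show "x \<in> ?V \<union> (+) (r m) ` ?V"
      using binary_digit_cases[of m u] by auto
  qed
  have "card (range (partial (Suc m))) \<le> card (?V \<union> (+) (r m) ` ?V)"
    using Suc sub by (intro card_mono) auto
  also have "\<dots> \<le> card ?V + card ?V"
    using Suc by (intro order_trans[OF card_Un_le] add_mono card_image_le) auto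
  also have "\<dots> \<le> 2 ^ Suc m"
    using Suc by simp
  finally show ?case
    using Suc sub finite_subset[OF sub] by auto
qed

section \<open>Upper estimate: coverings by digit prefixes\<close>

lemma cantor_dust_subset:
  "cantor_dust \<subseteq> (\<Union>a\<in>{x :: real ^ 'n. \<forall>j. x $ j \<in> range (partial m)}. cube a (2 * r m))"
proof
  fix x :: "real ^ 'n" assume "x \<in> cantor_dust"
  then obtain u where u: "\<And>j. x $ j = cantor_map (u j)"
    unfolding cantor_dust_def image_iff mem_Collect_eq by metis
  have "x \<in> cube (\<chi> j. partial m (u j)) (2 * r m)"
    using partial_le_cantor_map cantor_map_le_partial by (auto simp: cube_def mem_box_cart u)
  then show "x \<in> (\<Union>a\<in>{x. \<forall>j. x $ j \<in> range (partial m)}. cube a (2 * r m))"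
    by (intro UN_I[of "\<chi> j. partial m (u j)"]) auto
qed

text \<open>The hypothesis bounds the cost of the level-\<open>m\<close> covering. Its edges
  \<open>2 * r m\<close> tend to 0, so for every \<open>\<epsilon>\<close> it is eventually
  admissible and the premeasure lies below a null sequence.\<close>

lemma hausdorff_measure_cantor_dust_eq_0:
  assumes lim: "(\<lambda>m. (2 ^ m) ^ CARD('n) * (2 * r m) powr s) \<longlonglongrightarrow> 0"
  shows "hausdorff_measure s (cantor_dust :: (real ^ 'n) set) = 0"
proof (rule hausdorff_measure_eq_0I)
  fix \<epsilon> :: ennreal assume "0 < \<epsilon>"
  have "(\<lambda>m. ennreal (2 * r m)) \<longlonglongrightarrow> ennreal (2 * 0)"
    by (intro tendsto_intros r_tendsto_0)
  then have ev: "\<forall>\<^sub>F m in sequentially. ennreal (2 * r m) < \<epsilon>"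
    using \<open>0 < \<epsilon>\<close> by (simp add: order_tendstoD)
  have "(\<lambda>m. ennreal ((2 ^ m) ^ CARD('n) * (2 * r m) powr s)) \<longlonglongrightarrow> ennreal 0"
    by (intro tendsto_ennrealI lim)
  then have "hausdorff_premeasure s \<epsilon> (cantor_dust :: (real ^ 'n) set) \<le> ennreal 0"
  proof (rule tendsto_lowerbound)
    show "\<forall>\<^sub>F m in sequentially. hausdorff_premeasure s \<epsilon> (cantor_dust :: (real ^ 'n) set)
      \<le> ennreal ((2 ^ m) ^ CARD('n) * (2 * r m) powr s)"
      using ev
    proof eventually_elim
      case (elim m)
      let ?S = "{x :: real ^ 'n. \<forall>j. x $ j \<in> range (partial m)}"
      have "card ?S \<le> card (range (partial m)) ^ CARD('n)" "finite ?S"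
        using card_vec_le card_partial by blast+
      moreover have "card (range (partial m)) ^ CARD('n) \<le> (2 ^ m) ^ CARD('n)"
        using card_partial by (intro power_mono) auto
      ultimately have card: "card ?S \<le> (2 ^ m) ^ CARD('n)" "finite ?S"
        by (blast intro: order_trans)+
      have "hausdorff_premeasure s \<epsilon> (cantor_dust :: (real ^ 'n) set)
        \<le> ennreal (real (card ?S) * (2 * r m) powr s)"
        by (rule hausdorff_premeasure_le_finite[OF card(2) _ elim cantor_dust_subset])
          (use r_pos in simp)
      also have "\<dots> \<le> ennreal (real ((2 ^ m) ^ CARD('n)) * (2 * r m) powr s)"
        by (intro ennreal_leI mult_right_mono of_nat_mono card) auto
      finally show ?case
        by simp
    qed
  qed simp
  then show "hausdorff_premeasure s \<epsilon> (cantor_dust :: (real ^ 'n) set) = 0"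
    by simp
qed

section \<open>Lower estimate: pulling coverings back to the unit cube\<close>

lemma exists_scale:
  assumes "0 < l" "l \<le> r 0"
  shows "\<exists>m. r (Suc m) < l \<and> l \<le> r m"
proof -
  have "\<exists>m. r m < l"
    using order_tendstoD(2)[OF r_tendsto_0 assms(1)] by (auto simp: eventually_sequentially)
  then obtain m where "r m < l" "\<And>k. k < m \<Longrightarrow> l \<le> r k"
    using exists_least_iff[of "\<lambda>m. r m < l"] by (auto simp: not_less)
  \<comment> \<open>The least index with \<open>r m < l\<close> is not 0, since
    \<open>l \<le> r 0\<close>; its predecessor is the scale sought.\<close>
  then show ?thesis
    using assms by (cases m) auto
qed

lemma preimage_subset_cube:
  assumes "l \<le> 2 * r m"
  shows "\<exists>b. {u :: real ^ 'n. \<forall>j. u $ j \<in> {0..<1} \<and> cantor_map (u $ j) \<in> {a $ j..a $ j + l}}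
    \<subseteq> cube b (6 / 2 ^ m)" (is "\<exists>b. ?P \<subseteq> _")
proof (cases "?P = {}")
  case False
  then obtain w where w: "w \<in> ?P"
    by blast
  \<comment> \<open>All of \<open>?P\<close> lies within \<open>3 / 2 ^ m\<close> of
    \<open>w\<close> in each coordinate, so the cube is centred at \<open>w\<close>.\<close>
  have "?P \<subseteq> cube (\<chi> j. w $ j - 3 / 2 ^ m) (6 / 2 ^ m)"
  proof
    fix u assume u: "u \<in> ?P"
    have "\<bar>u $ j - w $ j\<bar> \<le> 3 / 2 ^ m" for j
    proof -
      have j: "u $ j \<in> {0..<1}" "w $ j \<in> {0..<1}"
        "cantor_map (u $ j) \<in> {a $ j..a $ j + l}" "cantor_map (w $ j) \<in> {a $ j..a $ j + l}"
        using u w by auto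
      then show ?thesis
        using cantor_map_expanding[of "u $ j" "w $ j" m] cantor_map_expanding[of "w $ j" "u $ j" m]
          assms by (cases "u $ j \<le> w $ j") auto
    qed
    then show "u \<in> cube (\<chi> j. w $ j - 3 / 2 ^ m) (6 / 2 ^ m)"
      by (auto simp: cube_def mem_box_cart abs_le_iff algebra_simps)
  qed
  then show ?thesis
    by blast
next
  case True
  show ?thesis
    unfolding True by simp
qed

text \<open>A cube of edge \<open>l\<close> with \<open>r (Suc m) < l \<le> r m\<close> has
  parameters in a cube of edge \<open>6 / 2 ^ m\<close>, whose volume is at most
  \<open>C * l powr s\<close> by the hypothesis on \<open>C\<close>. As the parameters fill the unit
  cube, every fine covering costs at least \<open>1 / C\<close>.\<close>

lemma hausdorff_measure_cantor_dust_pos: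
  assumes s: "0 \<le> s" and C: "\<And>m. (6 / 2 ^ m) ^ CARD('n) \<le> C * r (Suc m) powr s"
  shows "hausdorff_measure s (cantor_dust :: (real ^ 'n) set) \<noteq> 0"
proof -
  let ?E = "cantor_dust :: (real ^ 'n) set"
  have "0 < C * r (Suc 0) powr s"
    by (rule less_le_trans[OF _ C]) simp
  then have C_pos: "0 < C"
    using r_pos[of "Suc 0"] by (simp add: zero_less_mult_iff)
  \<comment> \<open>The mesh \<open>r 0\<close> ensures that \<open>exists_scale\<close> applies to
    every edge.\<close>
  have *: "ennreal (1 / C) \<le> (\<Sum>\<^sub>\<infinity>i\<in>I. ennreal (l i powr s))"
    if cover: "(I, a, l) \<in> cube_coverings (ennreal (r 0)) ?E" for I a l
  proof -
    have l: "0 < l i" "l i < r 0" if "i \<in> I" for i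
      using that cover by (auto simp: cube_coverings_def ennreal_less_iff)
    define P where
      "P i = {u :: real ^ 'n. \<forall>j. u $ j \<in> {0..<1} \<and> cantor_map (u $ j) \<in> {a i $ j..a i $ j + l i}}" for i
    have "\<exists>b c. P i \<subseteq> cube b c \<and> 0 \<le> c \<and> c ^ CARD('n) \<le> C * l i powr s" if "i \<in> I" for i
    proof -
      obtain m where m: "r (Suc m) < l i" "l i \<le> r m"
        using exists_scale[of "l i"] l[OF \<open>i \<in> I\<close>] by auto
      then obtain b where "P i \<subseteq> cube b (6 / 2 ^ m)"
        unfolding P_def using preimage_subset_cube[of "l i" m "a i"] r_pos[of m] by auto
      moreover have "(6 / 2 ^ m) ^ CARD('n) \<le> C * l i powr s"
        using m s C_pos r_pos[of "Suc m"]
        by (intro order_trans[OF C] mult_left_mono powr_mono2) auto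
      ultimately show ?thesis
        by (intro exI[of _ b] exI[of _ "6 / 2 ^ m"]) auto
    qed
    then obtain b c where bc: "\<And>i. i \<in> I \<Longrightarrow>
        P i \<subseteq> cube (b i) (c i) \<and> 0 \<le> c i \<and> c i ^ CARD('n) \<le> C * l i powr s"
      by metis
    \<comment> \<open>Enclosing cubes replace the preimages \<open>P i\<close>, giving Borel sets of
      known volume; empty sets fill the indices outside \<open>I\<close>.\<close>
    define A where "A i = (if i \<in> I then cube (b i) (c i) else {})" for i
    have A_sets: "A i \<in> sets lborel" for i
      by (simp add: A_def cube_def)
    have "box 0 (\<chi> j. 1) \<subseteq> (\<Union>i. A i)"
    proof
      fix u :: "real ^ 'n" assume "u \<in> box 0 (\<chi> j. 1)"
      then have u: "u $ j \<in> {0..<1}" for j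
        by (auto simp: mem_box_cart less_imp_le)
      then have "(\<chi> j. cantor_map (u $ j)) \<in> ?E"
        by (auto simp: cantor_dust_def)
      then obtain i where i: "i \<in> I" "(\<chi> j. cantor_map (u $ j)) \<in> cube (a i) (l i)"
        using cover by (auto simp: cube_coverings_def)
      then have "u \<in> P i"
        using u by (auto simp: P_def cube_def mem_box_cart)
      then show "u \<in> (\<Union>i. A i)"
        using i bc by (auto simp: A_def)
    qed
    then have "emeasure lborel (box 0 (\<chi> j. 1) :: (real ^ 'n) set) \<le> emeasure lborel (\<Union>i. A i)"
      using A_sets by (intro emeasure_mono) auto
    also have "\<dots> \<le> (\<Sum>i. emeasure lborel (A i))"
      using A_sets by (intro emeasure_subadditive_countably) auto
    finally have "1 \<le> (\<Sum>i. emeasure lborel (A i))"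
      using emeasure_lborel_cube[of 1 "0 :: real ^ 'n"]
      by (simp add: cube_def emeasure_lborel_box_eq emeasure_lborel_cbox_eq)
    then have "ennreal (1 / C) * 1 \<le> ennreal (1 / C) * (\<Sum>i. emeasure lborel (A i))"
      by (rule mult_left_mono) simp
    also have "\<dots> = (\<Sum>i. ennreal (1 / C) * emeasure lborel (A i))"
      by simp
    also have "\<dots> \<le> (\<Sum>\<^sub>\<infinity>i\<in>I. ennreal (l i powr s))"
    proof (rule suminf_le_infsum_ennreal)
      fix i assume i: "i \<in> I"
      then have "ennreal (1 / C) * emeasure lborel (A i) = ennreal (1 / C * c i ^ CARD('n))"
        using bc[OF i] C_pos by (simp add: A_def emeasure_lborel_cube flip: ennreal_mult)
      also have "\<dots> \<le> ennreal (l i powr s)"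
        using bc[OF i] C_pos by (intro ennreal_leI) (simp add: field_simps)
      finally show "ennreal (1 / C) * emeasure lborel (A i) \<le> ennreal (l i powr s)" .
    qed (simp add: A_def)
    finally show ?thesis
      by simp
  qed
  have "0 < ennreal (1 / C)"
    using C_pos by simp
  also have "\<dots> \<le> hausdorff_premeasure s (ennreal (r 0)) ?E"
    unfolding hausdorff_premeasure_def
  proof (rule INF_greatest)
    fix x assume "x \<in> cube_coverings (ennreal (r 0)) ?E"
    then show "ennreal (1 / C) \<le> (case x of (I, a, l) \<Rightarrow> \<Sum>\<^sub>\<infinity>i\<in>I. ennreal (l i powr s))"
      using * by (cases x) simp
  qed
  also have "\<dots> \<le> hausdorff_measure s ?E"
    unfolding hausdorff_measure_def by (rule SUP_upper) (use r_pos in simp)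
  finally show ?thesis
    by simp
qed

end

section \<open>Choice of the weights and computation of the dimension\<close>

theorem proposition2p3:
  fixes \<delta> :: real
  assumes "0 < \<delta>" and "\<delta> \<le> real CARD('n::finite)"
  shows "\<exists>E :: (real ^ 'n) set. hausdorff_dim E = ennreal \<delta> \<and> hausdorff_measure \<delta> E = 0"
proof -
  define N where "N = real CARD('n)"
  define r where "r m = 2 powr (- (N / \<delta>) * real m) / real (Suc m)" for m
  have N: "0 < N" "\<delta> \<le> N"
    using assms by (auto simp: N_def)
  interpret halving_sequence r
  proof
    fix m
    show "0 < r m"
      by (simp add: r_def)
    have "2 powr (- (N / \<delta>) * real (Suc m)) = 2 powr (- (N / \<delta>)) * 2 powr (- (N / \<delta>) * real m)"
      by (simp flip: powr_add add: algebra_simps)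
    \<comment> \<open>The bound \<open>\<delta> \<le> N\<close> enters here:
      \<open>N / \<delta>\<close> is at least 1, which gives the halving.\<close>
    also have "\<dots> \<le> 2 powr (- 1) * 2 powr (- (N / \<delta>) * real m)"
      using assms N by (intro mult_right_mono powr_mono) (auto simp: field_simps)
    finally have "2 * 2 powr (- (N / \<delta>) * real (Suc m)) \<le> 2 powr (- (N / \<delta>) * real m)"
      by (simp add: powr_minus field_simps)
    then have "2 * 2 powr (- (N / \<delta>) * real (Suc m)) / real (Suc (Suc m))
      \<le> 2 powr (- (N / \<delta>) * real m) / real (Suc m)"
      by (intro frac_le) auto
    then show "2 * r (Suc m) \<le> r m"
      by (simp add: r_def)
  qed
  let ?E = "cantor_dust :: (real ^ 'n) set"
  have two_power: "(2 ^ m) ^ CARD('n) = 2 powr (N * real m)" for m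
    using powr_realpow[of 2 "CARD('n) * m"] by (simp add: N_def mult.commute flip: power_mult)
  have zero: "hausdorff_measure \<delta> ?E = 0"
  proof (rule hausdorff_measure_cantor_dust_eq_0)
    \<comment> \<open>At the critical exponent the exponentials cancel, and only the factor
      \<open>1 / (m + 1)\<close> in \<open>r m\<close> forces decay.\<close>
    have "(2 ^ m) ^ CARD('n) * (2 * r m) powr \<delta> = 2 powr \<delta> * real (Suc m) powr - \<delta>" for m
    proof -
      have "- (N / \<delta>) * real m * \<delta> = - (N * real m)"
        using assms by simp
      then have "r m powr \<delta> = 2 powr (- (N * real m)) / real (Suc m) powr \<delta>"
        by (simp only: r_def powr_divide powr_powr)
      then have "(2 ^ m) ^ CARD('n) * (2 * r m) powr \<delta>
          = (2 powr (N * real m) * 2 powr (- (N * real m))) * (2 powr \<delta> / real (Suc m) powr \<delta>)"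
        using r_pos[of m] by (simp add: two_power powr_mult del: of_nat_Suc)
      also have "2 powr (N * real m) * 2 powr (- (N * real m)) = 1"
        by (simp flip: powr_add)
      finally show ?thesis
        by (simp add: powr_minus_divide)
    qed
    moreover have "(\<lambda>m. 2 powr \<delta> * real (Suc m) powr - \<delta>) \<longlonglongrightarrow> 0"
      using assms by real_asymp
    ultimately show "(\<lambda>m. (2 ^ m) ^ CARD('n) * (2 * r m) powr \<delta>) \<longlonglongrightarrow> 0"
      by simp
  qed
  have pos: "hausdorff_measure s ?E \<noteq> 0" if s: "0 \<le> s" "s < \<delta>" for s
  proof -
    \<comment> \<open>For \<open>s < \<delta>\<close> this is a positive exponential decay rate of
      \<open>f\<close>, which beats the polynomial factor \<open>(m + 2) powr s\<close>. Thus
      \<open>f\<close> is bounded, and a bound serves as \<open>C\<close>.\<close>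
    define q where "q = N - N * s / \<delta>"
    define f where "f m = (6 / 2 ^ m) ^ CARD('n) / r (Suc m) powr s" for m
    have q: "0 < q"
      using s assms N by (simp add: q_def field_simps)
    have f_eq: "f m = 6 powr N * 2 powr (N * s / \<delta>) * (2 powr (- q * real m) * real (m + 2) powr s)" for m
    proof -
      have "- (N / \<delta>) * real (Suc m) * s = - (N * s / \<delta> * real (Suc m))" "Suc (Suc m) = m + 2"
        by simp_all
      then have "r (Suc m) powr s = 2 powr (- (N * s / \<delta> * real (Suc m))) / real (m + 2) powr s"
        by (simp only: r_def powr_divide powr_powr)
      moreover have "(6 / 2 ^ m) ^ CARD('n) = 6 powr N * 2 powr (- (N * real m))"
        by (simp add: power_divide two_power powr_minus_divide) (simp add: N_def powr_realpow)
      ultimately have "f m = 6 powr N * (2 powr (- (N * real m)) * 2 powr (N * s / \<delta> * real (Suc m)))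
          * real (m + 2) powr s"
        by (simp add: f_def powr_minus_divide)
      also have "2 powr (- (N * real m)) * 2 powr (N * s / \<delta> * real (Suc m))
          = 2 powr (N * s / \<delta>) * 2 powr (- q * real m)"
        by (simp add: q_def algebra_simps add_divide_distrib flip: powr_add)
      finally show ?thesis
        by simp
    qed
    moreover have "(\<lambda>m. 6 powr N * 2 powr (N * s / \<delta>) * (2 powr (- q * real m) * real (m + 2) powr s)) \<longlonglongrightarrow> 0"
      using q by real_asymp
    ultimately have "f \<longlonglongrightarrow> 0"
      unfolding f_eq by simp
    then have "Bseq f"
      by (intro convergent_imp_Bseq convergentI)
    then obtain C where C: "\<And>m. norm (f m) \<le> C"
      unfolding Bseq_def by blast
    have "(6 / 2 ^ m) ^ CARD('n) \<le> C * r (Suc m) powr s" for m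
    proof -
      have "f m \<le> C"
        using C[of m] by (simp add: abs_le_iff)
      then show ?thesis
        unfolding f_def using r_pos[of "Suc m"] by (subst (asm) pos_divide_le_eq) simp_all
    qed
    then show ?thesis
      using s by (intro hausdorff_measure_cantor_dust_pos)
  qed
  \<comment> \<open>The dimension of the empty set is 0 by a separate clause, which must be ruled
    out.\<close>
  have "?E \<noteq> {}"
  proof -
    have "(\<chi> j. cantor_map 0) \<in> ?E"
      by (auto simp: cantor_dust_def)
    then show ?thesis
      by blast
  qed
  moreover have "(INF s\<in>{s. 0 \<le> s \<and> hausdorff_measure s ?E = 0}. ennreal s) = ennreal \<delta>"
  proof (rule antisym)
    show "(INF s\<in>{s. 0 \<le> s \<and> hausdorff_measure s ?E = 0}. ennreal s) \<le> ennreal \<delta>"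
      using assms zero by (intro INF_lower) auto
    show "ennreal \<delta> \<le> (INF s\<in>{s. 0 \<le> s \<and> hausdorff_measure s ?E = 0}. ennreal s)"
      \<comment> \<open>By \<open>pos\<close>, a nonnegative exponent with measure zero cannot lie
        below \<open>\<delta>\<close>.\<close>
      using pos by (intro INF_greatest ennreal_leI) force
  qed
  ultimately show ?thesis
    using zero by (auto simp: hausdorff_dim_def intro!: exI[of _ ?E])
qed

end
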